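(* Let $n\ge 2$ be an integer. Let $\mathfrak{A}$ and $\mathfrak{A}'$ be two $C^*$-algebras with identities $I_{\mathfrak{A}}$ and $I_{\mathfrak{A}'}$, respectively, let $P_1$ and $P_2=I_{\mathfrak{A}}-P_1$ be nontrivial projections in $\mathfrak{A}$, and let $\varphi:\mathfrak{A}\to\mathfrak{A}'$ be a map (not assumed additive). Suppose that for each $i\in\{1,2\}$ and each $X\in\mathfrak{A}'$, if $X\,\mathfrak{A}'\,\varphi(P_i)=\{0\}$ then $X=0$. Then $\varphi$ is a bijective unital multiplicative $*$-Lie-Jordan $n$-map if and only if $\varphi$ is a $*$-ring isomorphism.
   Context: For elements of a ring with involution $*$, put $[x,y]_*=xy-yx^*$ and $\{x,y\}_*=xy+yx^*$. Define recursively $p_{1*}(x)=x$, $p_{n*}(x_1,\dots,x_n)=[p_{(n-1)*}(x_1,\dots,x_{n-1}),x_n]_*$ and $q_{1*}(x)=x$, $q_{n*}(x_1,\dots,x_n)=\{q_{(n-1)*}(x_1,\dots,x_{n-1}),x_n\}_*$ for $n\ge 2$. A map $\varphi:\mathfrak{A}\to\mathfrak{A}'$ (not necessarily additive) is a multiplicative $*$-Lie-Jordan $n$-map if, for all $x_1,\dots,x_n\in\mathfrak{A}$, both $\varphi(p_{n*}(x_1,\dots,x_n))=p_{n*}(\varphi(x_1),\dots,\varphi(x_n))$ and $\varphi(q_{n*}(x_1,\dots,x_n))=q_{n*}(\varphi(x_1),\dots,\varphi(x_n))$ hold. It is unital if $\varphi(I_{\mathfrak{A}})=I_{\mathfrak{A}'}$.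 $C^*$-algebras are complex. A projection is a self-adjoint idempotent; it is nontrivial if it is neither $0$ nor the identity. A $*$-ring isomorphism is a bijection that is additive, multiplicative, and satisfies $\varphi(A^* )=\varphi(A)^*$ (no linearity is required). *)

theory Defs
  imports Complex_Main
begin

text \<open>
  Unital complex C*-algebras. Submultiplicativity of the norm comes from
  \<^class>\<open>real_normed_algebra\<close> and completeness from \<^class>\<open>banach\<close>; the real scalar
  multiplication these classes carry is the restriction of the complex one.
  The unit comes from \<^class>\<open>monoid_mult\<close> and not from \<^class>\<open>real_normed_algebra_1\<close>,
  because the latter demands \<open>0 \<noteq> 1\<close> and would exclude the zero algebra.
\<close>

class unital_cstar_algebra = real_normed_algebra + banach + monoid_mult +
  fixes scaleC :: "complex \<Rightarrow> 'a \<Rightarrow> 'a"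
    and star :: "'a \<Rightarrow> 'a"
  assumes scaleR_eq_scaleC: "scaleR r x = scaleC (complex_of_real r) x"
    and scaleC_add_right: "scaleC a (x + y) = scaleC a x + scaleC a y"
    and scaleC_add_left: "scaleC (a + b) x = scaleC a x + scaleC b x"
    and scaleC_scaleC: "scaleC a (scaleC b x) = scaleC (a * b) x"
    and scaleC_one: "scaleC 1 x = x"
    and mult_scaleC_left: "scaleC a x * y = scaleC a (x * y)"
    and mult_scaleC_right: "x * scaleC a y = scaleC a (x * y)"
    and norm_scaleC: "norm (scaleC a x) = cmod a * norm x"
    and star_add: "star (x + y) = star x + star y"
    and star_scaleC: "star (scaleC a x) = scaleC (cnj a) (star x)"
    and star_mult: "star (x * y) = star y * star x"
    and star_star: "star (star x) = x"
    and cstar_identity: "norm (star x * x) = (norm x)\<^sup>2"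

definition nontrivial_projection :: "'a::unital_cstar_algebra \<Rightarrow> bool" where
  "nontrivial_projection P \<longleftrightarrow> star P = P \<and> P * P = P \<and> P \<noteq> 0 \<and> P \<noteq> 1"

definition star_lie :: "'a::unital_cstar_algebra \<Rightarrow> 'a \<Rightarrow> 'a" where
  "star_lie x y = x * y - y * star x"

definition star_jordan :: "'a::unital_cstar_algebra \<Rightarrow> 'a \<Rightarrow> 'a" where
  "star_jordan x y = x * y + y * star x"

text \<open>
  A tuple \<open>(x\<^sub>1, \<dots>, x\<^sub>n)\<close> is given by a sequence \<open>x\<close>, of which only the entries
  \<open>x 1, \<dots>, x n\<close> are used. The value at \<open>n = 0\<close> is a dummy.
\<close>

fun p_star :: "nat \<Rightarrow> (nat \<Rightarrow> 'a::unital_cstar_algebra) \<Rightarrow> 'a" where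
  "p_star 0 x = 0"
| "p_star (Suc 0) x = x 1"
| "p_star (Suc (Suc n)) x = star_lie (p_star (Suc n) x) (x (Suc (Suc n)))"

fun q_star :: "nat \<Rightarrow> (nat \<Rightarrow> 'a::unital_cstar_algebra) \<Rightarrow> 'a" where
  "q_star 0 x = 0"
| "q_star (Suc 0) x = x 1"
| "q_star (Suc (Suc n)) x = star_jordan (q_star (Suc n) x) (x (Suc (Suc n)))"

definition multiplicative_star_lie_jordan_map ::
    "nat \<Rightarrow> ('a::unital_cstar_algebra \<Rightarrow> 'b::unital_cstar_algebra) \<Rightarrow> bool" where
  "multiplicative_star_lie_jordan_map n \<phi> \<longleftrightarrow>
     (\<forall>x. \<phi> (p_star n x) = p_star n (\<lambda>i. \<phi> (x i)) \<and>
          \<phi> (q_star n x) = q_star n (\<lambda>i. \<phi> (x i)))"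

definition star_ring_isomorphism ::
    "('a::unital_cstar_algebra \<Rightarrow> 'b::unital_cstar_algebra) \<Rightarrow> bool" where
  "star_ring_isomorphism \<phi> \<longleftrightarrow>
     bij \<phi> \<and> (\<forall>x y. \<phi> (x + y) = \<phi> x + \<phi> y) \<and> (\<forall>x y. \<phi> (x * y) = \<phi> x * \<phi> y) \<and>
     (\<forall>x. \<phi> (star x) = star (\<phi> x))"

end

theory Submission
  imports Defs
begin

text \<open>
  Why a unital bijective \<open>*\<close>-Lie-Jordan \<open>n\<close>-map \<open>\<phi> : \<AA> \<rightarrow> \<BB>\<close> is a \<open>*\<close>-ring isomorphism.

  \<^item> Units in all but the last two slots of the \<open>n\<close>-fold Jordan product, together with the
    fact that \<open>\<phi> \<i>\<close> is central, skew and invertible, show that \<open>\<phi>\<close> is compatible with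
    \<open>(x y + y x\<^sup>*) / 2\<close> and \<open>(x y - y x\<^sup>*) / 2\<close> (\<open>halved_lie_jordan_of_n_map\<close>).

  \<^item> The sum of these two products is \<open>x y\<close>, so
    \<open>\<phi> x \<phi> y = \<phi> ((x y + y x\<^sup>*) / 2) + \<phi> ((x y - y x\<^sup>*) / 2)\<close> without any additivity
    (\<open>mult_eq\<close>), and it remains to prove that \<open>\<phi>\<close> is additive.

  \<^item> The images of the projections \<open>P\<close> and \<open>Q = 1 - P\<close> are again complementary projections, and
    \<open>\<phi> P \<phi> z \<phi> Q = \<phi> (P z Q)\<close> (\<open>image_off_diagonal_component\<close>). For \<open>c\<close> in \<open>P \<AA> Q\<close> this gives
    \<open>\<phi> c \<phi> z \<phi> Q = \<phi> (c z Q)\<close> (\<open>image_off_diagonal_mult\<close>). By the faithfulness of the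
    projections, an element of \<open>\<phi> Q \<BB>\<close> is determined by its products with all such \<open>\<phi> c\<close>
    (\<open>annihilated_by_off_diagonal\<close>).

  \<^item> Hence additivity on \<open>P \<AA> Q\<close> spreads to the diagonal corner \<open>Q \<AA> Q\<close> (\<open>add_column\<close>), and by
    symmetry to everything. On \<open>P \<AA> Q\<close> it holds because there \<open>a + b = (P + a) (Q + b)\<close>
    (\<open>add_off_diagonal\<close>).

  The converse holds because the \<open>n\<close>-fold products are built from the ring operations and the
  involution.
\<close>

section \<open>The involution and scalars\<close>

lemma star_zero [simp]: "star (0 :: 'a::unital_cstar_algebra) = 0"
  using star_add[of "0::'a" 0] by simp

lemma star_uminus: "star (- x) = - star (x :: 'a::unital_cstar_algebra)"
  using star_add[of x "- x"] by (simp add: eq_neg_iff_add_eq_0 add.commute)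

lemma star_diff: "star (x - y) = star x - star (y :: 'a::unital_cstar_algebra)"
  using star_add[of x "- y"] by (simp add: star_uminus)

lemma star_one [simp]: "star (1 :: 'a::unital_cstar_algebra) = 1"
  using star_mult[of "star (1::'a)" 1] by (simp add: star_star)

lemma star_scaleR: "star (r *\<^sub>R x) = r *\<^sub>R star (x :: 'a::unital_cstar_algebra)"
  by (simp add: scaleR_eq_scaleC star_scaleC)

lemma half_double: "(1/2) *\<^sub>R (x + x) = (x :: 'a::real_vector)"
  by (simp flip: scaleR_2)

lemma star_jordan_lie_cancel:
  fixes x x' y y' :: "'a::unital_cstar_algebra"
  assumes "star_jordan x y = star_jordan x' y'" and "star_lie x y = star_lie x' y'"
  shows "x * y = x' * y'"
proof -
  have "2 *\<^sub>R (x * y) = star_jordan x y + star_lie x y" for x y :: 'a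
    by (simp add: star_jordan_def star_lie_def scaleR_2)
  then have "2 *\<^sub>R (x * y) = 2 *\<^sub>R (x' * y')"
    using assms by simp
  then show ?thesis by simp
qed

section \<open>Bijections compatible with the halved binary products\<close>

text \<open>
  The factor \<open>1/2\<close> makes both axioms independent of \<open>n\<close>: a bijection that preserves the unit and
  the \<open>n\<close>-fold products is not yet known to satisfy \<open>\<phi> (2 x) = 2 \<phi> x\<close>, but it satisfies
  \<open>\<phi> (2\<^sup>n\<^sup>-\<^sup>1 x) = 2\<^sup>n\<^sup>-\<^sup>1 \<phi> x\<close>, and this absorbs all scalars except one half.
\<close>

locale halved_lie_jordan =
  fixes \<phi> :: "'a::unital_cstar_algebra \<Rightarrow> 'b::unital_cstar_algebra"
  assumes bij: "bij \<phi>"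
    and zero [simp]: "\<phi> 0 = 0"
    and one [simp]: "\<phi> 1 = 1"
    and jordan: "\<phi> ((1/2) *\<^sub>R star_jordan x y) = (1/2) *\<^sub>R star_jordan (\<phi> x) (\<phi> y)"
    and lie: "\<phi> ((1/2) *\<^sub>R star_lie x y) = (1/2) *\<^sub>R star_lie (\<phi> x) (\<phi> y)"
begin

lemma phi_eq_iff: "\<phi> x = \<phi> y \<longleftrightarrow> x = y"
  using bij by (auto simp: bij_def inj_def)

lemma surjE: obtains x where "\<phi> x = y"
  using bij by (metis bij_pointE)

text \<open>
  The two halved products of \<open>x\<close> and \<open>y\<close> add up to \<open>x * y\<close>, in \<open>\<BB>\<close> as well as in \<open>\<AA>\<close>.
\<close>

lemma mult_eq:
  "\<phi> x * \<phi> y = \<phi> ((1/2) *\<^sub>R (x * y + y * star x)) + \<phi> ((1/2) *\<^sub>R (x * y - y * star x))"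
proof -
  have "\<phi> ((1/2) *\<^sub>R star_jordan x y) + \<phi> ((1/2) *\<^sub>R star_lie x y) =
        (1/2) *\<^sub>R (star_jordan (\<phi> x) (\<phi> y) + star_lie (\<phi> x) (\<phi> y))"
    by (simp add: jordan lie scaleR_add_right)
  also have "\<dots> = (1/2) *\<^sub>R (2 *\<^sub>R (\<phi> x * \<phi> y))"
    by (simp add: star_jordan_def star_lie_def scaleR_2)
  finally show ?thesis by (simp add: star_jordan_def star_lie_def)
qed

lemma selfadjoint:
  assumes "star h = h"
  shows "star (\<phi> h) = \<phi> h"
proof -
  have "\<phi> h = (1/2) *\<^sub>R (\<phi> h + star (\<phi> h))"
    using jordan[of h 1] assms by (simp add: star_jordan_def half_double)
  then have "2 *\<^sub>R \<phi> h = \<phi> h + star (\<phi> h)"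
    by (auto dest: arg_cong[where f = "\<lambda>x. 2 *\<^sub>R x"])
  then show ?thesis by (simp add: scaleR_2)
qed

lemma mult_selfadjoint_left:
  assumes "star h = h"
  shows "\<phi> h * \<phi> y = \<phi> ((1/2) *\<^sub>R (h * y + y * h)) + \<phi> ((1/2) *\<^sub>R (h * y - y * h))"
  using mult_eq[of h y] assms by simp

lemma mult_selfadjoint_right:
  assumes "star h = h"
  shows "\<phi> y * \<phi> h = \<phi> ((1/2) *\<^sub>R (h * y + y * h)) - \<phi> ((1/2) *\<^sub>R (h * y - y * h))"
proof -
  have "\<phi> ((1/2) *\<^sub>R star_jordan h y) - \<phi> ((1/2) *\<^sub>R star_lie h y) =
        (1/2) *\<^sub>R (star_jordan (\<phi> h) (\<phi> y) - star_lie (\<phi> h) (\<phi> y))"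
    by (simp add: jordan lie scaleR_diff_right)
  also have "\<dots> = (1/2) *\<^sub>R (\<phi> y * \<phi> h + \<phi> y * \<phi> h)"
    by (simp add: star_jordan_def star_lie_def selfadjoint[OF assms])
  finally show ?thesis
    by (simp add: star_jordan_def star_lie_def assms half_double)
qed

text \<open>
  Equations in \<open>\<BB>\<close> are pulled back along \<open>\<phi>\<close>: the two products in the assumptions determine
  both the Jordan and the Lie product of \<open>\<phi> x\<close> and \<open>\<phi> y\<close>, and \<open>\<phi>\<close> is injective.
\<close>

lemma mult_eq_if_image_products_eq:
  assumes "\<phi> x * \<phi> y = \<phi> x' * \<phi> y'" and "\<phi> y * star (\<phi> x) = \<phi> y' * star (\<phi> x')"
  shows "x * y = x' * y'"
proof (rule star_jordan_lie_cancel)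
  have "\<phi> ((1/2) *\<^sub>R star_jordan x y) = \<phi> ((1/2) *\<^sub>R star_jordan x' y')"
    unfolding jordan using assms by (simp add: star_jordan_def)
  then show "star_jordan x y = star_jordan x' y'" by (simp add: phi_eq_iff)
  have "\<phi> ((1/2) *\<^sub>R star_lie x y) = \<phi> ((1/2) *\<^sub>R star_lie x' y')"
    unfolding lie using assms by (simp add: star_lie_def)
  then show "star_lie x y = star_lie x' y'" by (simp add: phi_eq_iff)
qed

lemma mult_selfadjoint_cancel:
  assumes "star h = h" and "\<phi> x * \<phi> h = \<phi> x' * \<phi> h"
  shows "x * h = x' * h"
proof (rule mult_eq_if_image_products_eq)
  show "\<phi> h * star (\<phi> x) = \<phi> h * star (\<phi> x')"
    using arg_cong[OF assms(2), of star] by (simp add: star_mult selfadjoint[OF assms(1)])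
qed (fact assms(2))

text \<open>
  All that is missing is additivity: once \<open>\<phi>\<close> is additive, the two summands in the formula for
  \<open>\<phi> x * \<phi> y\<close> add up to \<open>\<phi> (x * y)\<close>, and the Jordan product with \<open>1\<close> yields the involution.
\<close>

lemma star_ring_isomorphism_if_additive:
  assumes add: "\<And>x y. \<phi> (x + y) = \<phi> x + \<phi> y"
  shows "star_ring_isomorphism \<phi>"
proof -
  have mult: "\<phi> (x * y) = \<phi> x * \<phi> y" for x y
    by (simp add: mult_eq[of x y] scaleR_2 flip: add scaleR_add_right)
  have "\<phi> (star x) = star (\<phi> x)" for x
  proof -
    have half: "\<phi> ((1/2) *\<^sub>R z) = (1/2) *\<^sub>R \<phi> z" for z
      using add[of "(1/2) *\<^sub>R z" "(1/2) *\<^sub>R z"]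
      by (simp add: half_double flip: scaleR_add_right scaleR_2)
    show ?thesis
      using jordan[of x 1] by (simp add: star_jordan_def half add)
  qed
  then show ?thesis
    by (simp add: star_ring_isomorphism_def bij add mult)
qed

end

section \<open>Peirce components\<close>

locale halved_lie_jordan_peirce = halved_lie_jordan \<phi>
  for \<phi> :: "'a::unital_cstar_algebra \<Rightarrow> 'b::unital_cstar_algebra" +
  fixes P Q :: 'a
  assumes P_star: "star P = P" and P_idem: "P * P = P" and Q_def: "Q = 1 - P"
    and faithful_P: "\<And>X. (\<And>Y. X * Y * \<phi> P = 0) \<Longrightarrow> X = 0"
    and faithful_Q: "\<And>X. (\<And>Y. X * Y * \<phi> Q = 0) \<Longrightarrow> X = 0"
begin

lemma swap: "halved_lie_jordan_peirce \<phi> Q P"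
proof
  show "star Q = Q" "Q * Q = Q" "P = 1 - Q"
    by (simp_all add: Q_def P_star P_idem star_diff algebra_simps)
qed (fact faithful_Q faithful_P)+

lemma Q_star: "star Q = Q" and Q_idem: "Q * Q = Q" and PQ: "P * Q = 0" and QP: "Q * P = 0"
  and PQ_sum: "P + Q = 1"
  by (auto simp: Q_def P_star P_idem star_diff algebra_simps)

lemma P_left_assoc: "P * (P * x) = P * x" and Q_left_assoc: "Q * (Q * x) = Q * x"
  and PQ_left_assoc: "P * (Q * x) = 0" and QP_left_assoc: "Q * (P * x) = 0"
  by (simp_all add: P_idem Q_idem PQ QP flip: mult.assoc)

lemmas PQ_simps = P_star Q_star P_idem Q_idem PQ QP
  P_left_assoc Q_left_assoc PQ_left_assoc QP_left_assoc mult.assoc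

lemma image_P_star: "star (\<phi> P) = \<phi> P" and image_Q_star: "star (\<phi> Q) = \<phi> Q"
  by (simp_all add: selfadjoint P_star Q_star)

lemma image_P_idem: "\<phi> P * \<phi> P = \<phi> P" and image_Q_idem: "\<phi> Q * \<phi> Q = \<phi> Q"
  by (simp_all add: mult_selfadjoint_left P_star Q_star P_idem Q_idem half_double)

lemma image_PQ: "\<phi> P * \<phi> Q = 0" and image_QP: "\<phi> Q * \<phi> P = 0"
  by (simp_all add: mult_selfadjoint_left P_star Q_star PQ QP)

text \<open>
  Let \<open>x\<close> be the preimage of the defect \<open>1 - \<phi> P - \<phi> Q\<close>. The defect annihilates \<open>\<phi> P\<close> and
  \<open>\<phi> Q\<close>, so by injectivity \<open>x\<close> annihilates \<open>P\<close> and \<open>Q\<close>.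
\<close>

lemma image_PQ_sum: "\<phi> P + \<phi> Q = 1"
proof -
  obtain x where x: "\<phi> x = 1 - \<phi> P - \<phi> Q" by (rule surjE)
  have annihilates: "h * x = 0"
    if "star h = h" "\<phi> h * \<phi> x = 0" "\<phi> x * \<phi> h = 0" for h
    using mult_eq_if_image_products_eq[of h x 0 0] that by (simp add: selfadjoint)
  have "P * x = 0" and "Q * x = 0"
    by (rule annihilates; simp add: x PQ_simps algebra_simps
        image_P_idem image_Q_idem image_PQ image_QP)+
  then have "x = 0" using PQ_sum by (metis distrib_right mult_1 add_0)
  then show ?thesis using x by (simp add: algebra_simps)
qed

lemma image_P_left_assoc: "\<phi> P * (\<phi> P * X) = \<phi> P * X"
  and image_Q_left_assoc: "\<phi> Q * (\<phi> Q * X) = \<phi> Q * X"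
  and image_PQ_left_assoc: "\<phi> P * (\<phi> Q * X) = 0"
  and image_QP_left_assoc: "\<phi> Q * (\<phi> P * X) = 0"
  by (simp_all add: image_P_idem image_Q_idem image_PQ image_QP flip: mult.assoc)

lemmas image_PQ_simps = image_P_idem image_Q_idem image_PQ image_QP
  image_P_left_assoc image_Q_left_assoc image_PQ_left_assoc image_QP_left_assoc mult.assoc

text \<open>
  In what follows the space \<open>P \<AA> Q\<close> is described by the equations \<open>P * a = a\<close> and \<open>a * P = 0\<close>.
\<close>

lemma off_diagonal_Q:
  assumes "P * a = a" and "a * P = 0"
  shows "Q * a = 0" and "a * Q = a"
  using assms by (simp_all add: Q_def algebra_simps)

lemma image_Q_eq: "\<phi> Q = 1 - \<phi> P"
  using image_PQ_sum by (simp add: algebra_simps)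

lemma image_P_mult_off_diagonal:
  assumes "P * a = a" and "a * P = 0"
  shows "\<phi> P * \<phi> a = 2 *\<^sub>R \<phi> ((1/2) *\<^sub>R a)" and "\<phi> a * \<phi> P = 0"
  using mult_selfadjoint_left[OF P_star, of a] mult_selfadjoint_right[OF P_star, of a] assms
  by (simp_all add: scaleR_2)

lemma off_diagonal_half:
  assumes "P * a = a" and "a * P = 0"
  shows "\<phi> ((1/2) *\<^sub>R a) = (1/2) *\<^sub>R \<phi> a"
proof -
  \<comment> \<open>Multiplying by the idempotent \<open>\<phi> P\<close> twice halves the argument \<open>2 a\<close> twice.\<close>
  have "2 *\<^sub>R \<phi> a = \<phi> P * \<phi> (2 *\<^sub>R a)"
    using assms by (subst image_P_mult_off_diagonal) simp_all
  also have "\<dots> = \<phi> P * (\<phi> P * \<phi> (2 *\<^sub>R a))"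
    by (simp add: image_PQ_simps)
  also have "\<phi> P * \<phi> (2 *\<^sub>R a) = 2 *\<^sub>R \<phi> a"
    using assms by (subst image_P_mult_off_diagonal) simp_all
  also have "\<phi> P * (2 *\<^sub>R \<phi> a) = 2 *\<^sub>R 2 *\<^sub>R \<phi> ((1/2) *\<^sub>R a)"
    unfolding mult_scaleR_right image_P_mult_off_diagonal(1)[OF assms] ..
  finally have "\<phi> a = 2 *\<^sub>R \<phi> ((1/2) *\<^sub>R a)"
    by (rule scaleR_left_imp_eq[rotated]) simp
  then show ?thesis by simp
qed

lemma image_off_diagonal:
  assumes "P * a = a" and "a * P = 0"
  shows "\<phi> P * \<phi> a = \<phi> a" and "\<phi> a * \<phi> P = 0" and "\<phi> Q * \<phi> a = 0" and "\<phi> a * \<phi> Q = \<phi> a"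
proof -
  show left: "\<phi> P * \<phi> a = \<phi> a"
    unfolding image_P_mult_off_diagonal(1)[OF assms] off_diagonal_half[OF assms] by simp
  show right: "\<phi> a * \<phi> P = 0"
    by (rule image_P_mult_off_diagonal[OF assms])
  show "\<phi> Q * \<phi> a = 0" and "\<phi> a * \<phi> Q = \<phi> a"
    using left right by (simp_all add: image_Q_eq algebra_simps)
qed

text \<open>
  The preimage \<open>t\<close> of \<open>\<phi> a + \<phi> b\<close> has \<open>t * P = b * P\<close> and \<open>t * Q = a * Q\<close>, because one summand
  dies on each side.
\<close>

lemma add_opposite_off_diagonal:
  assumes a: "P * a = a" "a * P = 0" and b: "Q * b = b" "b * Q = 0"
  shows "\<phi> (a + b) = \<phi> a + \<phi> b"
proof -
  obtain t where t: "\<phi> t = \<phi> a + \<phi> b" by (rule surjE)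
  note image_a = image_off_diagonal[OF a]
    and image_b = halved_lie_jordan_peirce.image_off_diagonal[OF swap b]
  have "t * P = b * P"
    by (rule mult_selfadjoint_cancel) (simp_all add: P_star t distrib_right image_a)
  moreover have "t * Q = a * Q"
    by (rule mult_selfadjoint_cancel) (simp_all add: Q_star t distrib_right image_b)
  moreover have "t = t * P + t * Q"
    by (simp add: PQ_sum flip: distrib_left)
  ultimately have "t = b + a"
    using off_diagonal_Q[OF a] halved_lie_jordan_peirce.off_diagonal_Q[OF swap b] by simp
  then show ?thesis using t by (simp add: add.commute)
qed

text \<open>
  The commutator with \<open>P\<close> is a Lie product, hence compatible with \<open>\<phi>\<close>. It removes the diagonal
  part of \<open>z\<close> and leaves \<open>P * z * Q - Q * z * P\<close>, whose two terms lie in opposite off-diagonal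
  spaces, where sums are already known to be preserved.
\<close>

lemma image_off_diagonal_component: "\<phi> P * \<phi> z * \<phi> Q = \<phi> (P * z * Q)"
proof -
  interpret swap: halved_lie_jordan_peirce \<phi> Q P by (rule swap)
  let ?a = "P * z * Q" and ?b = "- (Q * z * P)"
  have a: "P * ?a = ?a" "?a * P = 0" and b: "Q * ?b = ?b" "?b * Q = 0"
    by (simp_all add: PQ_simps)
  have "?a + ?b = P * z * (P + Q) - (P + Q) * z * P"
    by (simp add: algebra_simps)
  then have commutator: "star_lie P z = ?a + ?b"
    by (simp add: PQ_sum star_lie_def P_star)
  have halves: "(1/2) *\<^sub>R (?a + ?b) = (1/2) *\<^sub>R ?a + (1/2) *\<^sub>R ?b"
    by (rule scaleR_add_right)
  have "\<phi> ((1/2) *\<^sub>R (?a + ?b)) = \<phi> ((1/2) *\<^sub>R ?a) + \<phi> ((1/2) *\<^sub>R ?b)"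
    unfolding halves using a b by (intro add_opposite_off_diagonal) simp_all
  then have "(1/2) *\<^sub>R star_lie (\<phi> P) (\<phi> z) = (1/2) *\<^sub>R (\<phi> ?a + \<phi> ?b)"
    unfolding lie[symmetric] commutator off_diagonal_half[OF a] swap.off_diagonal_half[OF b]
    by (simp add: scaleR_add_right)
  then have "\<phi> P * \<phi> z - \<phi> z * \<phi> P = \<phi> ?a + \<phi> ?b"
    by (simp add: star_lie_def image_P_star)
  moreover have "\<phi> P * (\<phi> P * \<phi> z - \<phi> z * \<phi> P) * \<phi> Q = \<phi> P * \<phi> z * \<phi> Q"
    by (simp add: algebra_simps image_PQ_simps)
  moreover have "\<phi> P * (\<phi> ?a + \<phi> ?b) * \<phi> Q = \<phi> ?a"
    by (simp only: distrib_left distrib_right image_off_diagonal[OF a]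
        swap.image_off_diagonal[OF b] mult_zero_left add_0_right)
  ultimately show ?thesis by simp
qed

text \<open>
  In the chosen component both summands of \<open>mult_eq\<close> equal \<open>\<phi> (P * x * y * Q / 2)\<close>, so they can
  be added by homogeneity alone.
\<close>

lemma image_mult_component:
  assumes "Q * x = 0"
  shows "\<phi> P * (\<phi> x * \<phi> y) * \<phi> Q = \<phi> (P * x * y * Q)"
proof -
  \<comment> \<open>The terms \<open>y * star x\<close> do not contribute to this Peirce component.\<close>
  have "star x * Q = 0"
    using assms by (metis Q_star star_mult star_zero)
  then have "P * ((1/2) *\<^sub>R (x * y + y * star x)) * Q = (1/2) *\<^sub>R (P * x * y * Q)"
    and "P * ((1/2) *\<^sub>R (x * y - y * star x)) * Q = (1/2) *\<^sub>R (P * x * y * Q)"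
    by (simp_all add: algebra_simps)
  then have "\<phi> P * (\<phi> x * \<phi> y) * \<phi> Q = 2 *\<^sub>R \<phi> ((1/2) *\<^sub>R (P * x * y * Q))"
    by (simp add: mult_eq[of x y] distrib_left distrib_right image_off_diagonal_component scaleR_2)
  also have "\<phi> ((1/2) *\<^sub>R (P * x * y * Q)) = (1/2) *\<^sub>R \<phi> (P * x * y * Q)"
    by (rule off_diagonal_half) (simp_all add: PQ_simps)
  finally show ?thesis by simp
qed

lemma image_off_diagonal_mult:
  assumes "P * c = c" and "c * P = 0"
  shows "\<phi> c * \<phi> z * \<phi> Q = \<phi> (c * z * Q)"
proof -
  have "\<phi> c * \<phi> z * \<phi> Q = \<phi> P * \<phi> c * \<phi> z * \<phi> Q"
    by (simp add: image_off_diagonal[OF assms])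
  also have "\<dots> = \<phi> (P * c * z * Q)"
    unfolding mult.assoc[of "\<phi> P" "\<phi> c"]
    by (rule image_mult_component) (rule off_diagonal_Q[OF assms])
  finally show ?thesis by (simp add: assms)
qed

text \<open>
  This is where the faithfulness hypothesis enters: the images of \<open>P \<AA> Q\<close> exhaust
  \<open>\<phi> P \<BB> \<phi> Q\<close>, so the adjoint of \<open>\<phi> Q * X\<close> annihilates \<open>\<BB> \<phi> P\<close>.
\<close>

lemma annihilated_by_off_diagonal:
  assumes annihilated: "\<And>c. P * c = c \<Longrightarrow> c * P = 0 \<Longrightarrow> \<phi> c * X = 0"
  shows "\<phi> Q * X = 0"
proof -
  have "star (\<phi> Q * X) * Y * \<phi> P = 0" for Y
  proof -
    obtain y where y: "\<phi> y = star Y" by (rule surjE)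
    have "\<phi> P * star Y * (\<phi> Q * X) = \<phi> (P * y * Q) * X"
      unfolding image_off_diagonal_component[symmetric] y by (simp only: mult.assoc)
    also have "\<dots> = 0"
      by (rule annihilated) (simp_all add: PQ_simps)
    finally have "star (\<phi> P * star Y * (\<phi> Q * X)) = 0" by simp
    then show ?thesis
      by (simp add: star_mult star_star image_P_star mult.assoc)
  qed
  then have "star (\<phi> Q * X) = 0" by (rule faithful_P)
  then show ?thesis by (metis star_star star_zero)
qed

section \<open>Additivity\<close>

text \<open>
  Diagonal components are compared through their action on \<open>P \<AA> Q\<close>. The case of the unit of the
  corner is what the product \<open>(P + a) * (Q + b)\<close> below needs.
\<close>

lemma image_diagonal_component_eq:
  assumes "Q * z * Q = Q"
  shows "\<phi> Q * \<phi> z * \<phi> Q = \<phi> Q"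
proof -
  have "\<phi> Q * (\<phi> z * \<phi> Q - \<phi> Q) = 0"
  proof (rule annihilated_by_off_diagonal)
    fix c assume c: "P * c = c" "c * P = 0"
    have "c * z * Q = c * (Q * z * Q)"
      using off_diagonal_Q[OF c] by (simp flip: mult.assoc)
    then have "c * z * Q = c"
      using off_diagonal_Q[OF c] by (simp add: assms)
    then have "\<phi> c * \<phi> z * \<phi> Q = \<phi> c * \<phi> Q"
      by (simp add: image_off_diagonal_mult[OF c] image_off_diagonal[OF c])
    then show "\<phi> c * (\<phi> z * \<phi> Q - \<phi> Q) = 0"
      by (simp add: algebra_simps)
  qed
  then show ?thesis by (simp add: algebra_simps image_PQ_simps)
qed

text \<open>
  Addition within \<open>P \<AA> Q\<close> is a product: \<open>(P + a) * (Q + b) = a + b\<close>.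
\<close>

lemma add_off_diagonal:
  assumes a: "P * a = a" "a * P = 0" and b: "P * b = b" "b * P = 0"
  shows "\<phi> (a + b) = \<phi> a + \<phi> b"
proof -
  interpret swap: halved_lie_jordan_peirce \<phi> Q P by (rule swap)
  note Qa = off_diagonal_Q[OF a] and Qb = off_diagonal_Q[OF b]
  have ab: "a * b = 0"
    by (metis a(2) b(1) mult.assoc mult_zero_left)
  have "\<phi> (a + b) = \<phi> (P * (P + a) * (Q + b) * Q)"
    using a b Qa Qb ab by (simp add: algebra_simps PQ_simps)
  also have "\<dots> = \<phi> P * (\<phi> (P + a) * \<phi> (Q + b)) * \<phi> Q"
    by (rule image_mult_component[symmetric]) (simp add: distrib_left QP Qa)
  also have "\<dots> = \<phi> P * (\<phi> (P + a) * (\<phi> P + \<phi> Q) * \<phi> (Q + b)) * \<phi> Q"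
    by (simp add: image_PQ_sum)
  also have "\<dots> = (\<phi> P * \<phi> (P + a) * \<phi> P) * (\<phi> P * \<phi> (Q + b) * \<phi> Q) +
                  (\<phi> P * \<phi> (P + a) * \<phi> Q) * (\<phi> Q * \<phi> (Q + b) * \<phi> Q)"
    by (simp add: algebra_simps image_PQ_simps)
  also have "\<phi> P * \<phi> (P + a) * \<phi> P = \<phi> P"
    by (rule swap.image_diagonal_component_eq) (simp add: distrib_left distrib_right P_idem a)
  also have "\<phi> P * \<phi> (Q + b) * \<phi> Q = \<phi> b"
    by (simp add: image_off_diagonal_component distrib_left distrib_right b Qb PQ)
  also have "\<phi> P * \<phi> (P + a) * \<phi> Q = \<phi> a"
    by (simp add: image_off_diagonal_component distrib_left distrib_right a Qa PQ P_idem)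
  also have "\<phi> Q * \<phi> (Q + b) * \<phi> Q = \<phi> Q"
    by (rule image_diagonal_component_eq) (simp add: distrib_left distrib_right Q_idem Qb)
  finally show ?thesis
    by (simp add: image_off_diagonal[OF a] image_off_diagonal[OF b] add.commute)
qed

lemma P_off_diagonal_assoc: "P * (c * x) = c * x" if "P * c = c"
  using that by (simp flip: mult.assoc)

text \<open>
  The \<open>\<phi> P\<close>-row of the defect vanishes by additivity on \<open>P \<AA> Q\<close>. For the \<open>\<phi> Q\<close>-row, multiplying
  from the left by \<open>\<phi> c\<close> with \<open>c\<close> in \<open>P \<AA> Q\<close> moves the question to \<open>P \<AA> Q\<close> again.
\<close>

lemma add_column: "\<phi> (x + y) * \<phi> Q = \<phi> x * \<phi> Q + \<phi> y * \<phi> Q"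
proof -
  let ?D = "\<phi> (x + y) * \<phi> Q - (\<phi> x * \<phi> Q + \<phi> y * \<phi> Q)"
  have "\<phi> P * ?D = \<phi> P * \<phi> (x + y) * \<phi> Q - (\<phi> P * \<phi> x * \<phi> Q + \<phi> P * \<phi> y * \<phi> Q)"
    by (simp add: algebra_simps)
  also have "\<dots> = \<phi> (P * x * Q + P * y * Q) - (\<phi> (P * x * Q) + \<phi> (P * y * Q))"
    by (simp add: image_off_diagonal_component distrib_left distrib_right)
  also have "\<dots> = 0"
    by (subst add_off_diagonal) (simp_all add: PQ_simps)
  finally have "\<phi> P * ?D = 0" .
  moreover have "\<phi> Q * ?D = 0"
  proof (rule annihilated_by_off_diagonal)
    fix c assume c: "P * c = c" "c * P = 0"
    have "\<phi> c * ?D = \<phi> c * \<phi> (x + y) * \<phi> Q - (\<phi> c * \<phi> x * \<phi> Q + \<phi> c * \<phi> y * \<phi> Q)"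
      by (simp add: algebra_simps)
    also have "\<dots> = \<phi> (c * x * Q + c * y * Q) - (\<phi> (c * x * Q) + \<phi> (c * y * Q))"
      by (simp add: image_off_diagonal_mult[OF c] distrib_left distrib_right)
    also have "\<dots> = 0"
      by (subst add_off_diagonal) (simp_all add: PQ_simps P_off_diagonal_assoc[OF c(1)])
    finally show "\<phi> c * ?D = 0" .
  qed
  ultimately have "(\<phi> P + \<phi> Q) * ?D = 0"
    by (simp only: distrib_right add_0)
  then show ?thesis by (simp add: image_PQ_sum)
qed

lemma additive: "\<phi> (x + y) = \<phi> x + \<phi> y"
proof -
  interpret swap: halved_lie_jordan_peirce \<phi> Q P by (rule swap)
  have "\<phi> (x + y) * (\<phi> P + \<phi> Q) = (\<phi> x + \<phi> y) * (\<phi> P + \<phi> Q)"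
    by (simp add: distrib_left distrib_right add_column swap.add_column algebra_simps)
  then show ?thesis by (simp add: image_PQ_sum)
qed

end

section \<open>From \<open>n\<close>-fold to binary products\<close>

lemma q_star_ones:
  assumes "\<And>i. 1 \<le> i \<Longrightarrow> i \<le> m \<Longrightarrow> x i = 1"
  shows "q_star (Suc m) x = 2 ^ m *\<^sub>R x (Suc m)"
  using assms
proof (induction m)
  case (Suc m)
  then have "q_star (Suc m) x = 2 ^ m *\<^sub>R 1" by simp
  then show ?case
    by (simp add: star_jordan_def star_scaleR flip: scaleR_2)
qed simp

lemma p_star_skew_ones:
  assumes "star (x 1) = - x 1" and "\<And>i. 2 \<le> i \<Longrightarrow> i \<le> Suc m \<Longrightarrow> x i = 1"
  shows "p_star (Suc m) x = 2 ^ m *\<^sub>R x 1"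
  using assms(2)
proof (induction m)
  case (Suc m)
  then have "p_star (Suc m) x = 2 ^ m *\<^sub>R x 1" by simp
  then show ?case
    using Suc.prems[of "Suc (Suc m)"] assms(1)
    by (simp add: star_lie_def star_scaleR flip: scaleR_2)
qed simp

lemma scaleC_minus_one: "scaleC (- 1) x = - (x :: 'a::unital_cstar_algebra)"
  using scaleR_eq_scaleC[of "- 1" x] by simp

text \<open>
  Filling the first \<open>n - 2\<close> slots of \<open>q\<^sub>n\<^sub>*\<close> with \<open>1\<close> gives \<open>2\<^sup>n\<^sup>-\<^sup>2\<close> times the Jordan product of the
  other two. For \<open>p\<^sub>n\<^sub>*\<close> this fails, since \<open>p\<^sub>2\<^sub>*(1, x) = 0\<close>. The Lie product is
  obtained instead as \<open>x y - y x\<^sup>* = - \<i> ((\<i> x) y + y (\<i> x)\<^sup>*)\<close>, which requires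
  \<open>\<phi> (\<i> x) = J \<phi> x\<close> for a central, skew and invertible \<open>J\<close>; the value of \<open>p\<^sub>n\<^sub>*\<close> at
  \<open>(\<i>, 1, \<dots>, 1, x)\<close> provides it, with \<open>J = \<phi> \<i>\<close>.
\<close>

lemma halved_lie_jordan_of_n_map:
  fixes \<phi> :: "'a::unital_cstar_algebra \<Rightarrow> 'b::unital_cstar_algebra"
  assumes n: "n \<ge> 2" and bij: "bij \<phi>" and one: "\<phi> 1 = 1"
    and map: "multiplicative_star_lie_jordan_map n \<phi>"
  shows "halved_lie_jordan \<phi>"
proof -
  obtain m where m: "n = Suc (Suc m)" using n by (metis add_2_eq_Suc le_Suc_ex)
  define c :: real where "c = 2 ^ m"
  have double_c_nonzero: "2 * c \<noteq> 0" by (simp add: c_def)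
  obtain k where k: "\<phi> k = 0" using bij by (metis bij_pointE)

  have scaled_jordan: "\<phi> (c *\<^sub>R star_jordan x y) = c *\<^sub>R star_jordan (\<phi> x) (\<phi> y)" for x y
  proof -
    let ?s = "\<lambda>i. if i = Suc m then x else if i = n then y else 1"
    have "q_star n ?s = c *\<^sub>R star_jordan x y"
      using q_star_ones[of m ?s]
      by (simp add: m c_def star_jordan_def star_scaleR scaleR_add_right)
    moreover have "q_star n (\<lambda>i. \<phi> (?s i)) = c *\<^sub>R star_jordan (\<phi> x) (\<phi> y)"
      using q_star_ones[of m "\<lambda>i. \<phi> (?s i)"]
      by (simp add: m c_def star_jordan_def star_scaleR scaleR_add_right one)
    moreover have "\<phi> (q_star n ?s) = q_star n (\<lambda>i. \<phi> (?s i))"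
      using map by (simp add: multiplicative_star_lie_jordan_map_def)
    ultimately show ?thesis by simp
  qed

  have zero: "\<phi> 0 = 0"
    using scaled_jordan[of k 0] k by (simp add: star_jordan_def)
  have scaled: "\<phi> ((2 * c) *\<^sub>R x) = (2 * c) *\<^sub>R \<phi> x" for x
    using scaled_jordan[of 1 x]
    by (simp add: star_jordan_def one mult.commute flip: scaleR_2)
  have halved_jordan: "\<phi> ((1/2) *\<^sub>R star_jordan x y) = (1/2) *\<^sub>R star_jordan (\<phi> x) (\<phi> y)" for x y
  proof -
    have "(2 * c) *\<^sub>R \<phi> ((1/2) *\<^sub>R star_jordan x y) = (2 * c) *\<^sub>R (1/2) *\<^sub>R star_jordan (\<phi> x) (\<phi> y)"
      using scaled_jordan[of x y] by (simp flip: scaled)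
    with double_c_nonzero show ?thesis by (rule scaleR_left_imp_eq)
  qed

  define \<iota> :: 'a where "\<iota> = scaleC \<i> 1"
  define J where "J = \<phi> \<iota>"
  have \<iota>_star: "star \<iota> = - \<iota>"
    using scaleC_scaleC[of "- 1" \<i> "1::'a"] by (simp add: \<iota>_def star_scaleC scaleC_minus_one)
  have \<iota>_central: "x * \<iota> = \<iota> * x" for x
    by (simp add: \<iota>_def mult_scaleC_left mult_scaleC_right)
  have \<iota>_square: "\<iota> * (\<iota> * x) = - x" for x
    by (simp add: \<iota>_def mult_scaleC_left scaleC_scaleC scaleC_minus_one)

  \<comment> \<open>Both facts on \<open>J\<close> express that \<open>\<phi>\<close> maps a vanishing Jordan product with \<open>\<iota>\<close> to \<open>0\<close>.\<close>
  have J_skew: "star J = - J"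
    using halved_jordan[of \<iota> 1]
    by (simp add: star_jordan_def \<iota>_star zero one J_def add_eq_0_iff)
  have J_central: "J * y = y * J" for y
  proof -
    obtain x where x: "\<phi> x = y" using bij by (metis bij_pointE)
    show ?thesis
      using halved_jordan[of \<iota> x] x
      by (simp add: star_jordan_def \<iota>_star \<iota>_central zero J_skew flip: J_def)
  qed
  have image_\<iota>_mult: "\<phi> (\<iota> * x) = J * \<phi> x" for x
  proof -
    let ?s = "\<lambda>i. if i = 1 then \<iota> else if i = n then x else 1"
    have "p_star n ?s = (2 * c) *\<^sub>R (\<iota> * x)"
      using p_star_skew_ones[of ?s m]
      by (simp add: m c_def star_lie_def star_scaleR \<iota>_star \<iota>_central mult.commute flip: scaleR_2)
    moreover have "p_star n (\<lambda>i. \<phi> (?s i)) = (2 * c) *\<^sub>R (J * \<phi> x)"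
      using p_star_skew_ones[of "\<lambda>i. \<phi> (?s i)" m] J_skew J_central[of "\<phi> x"]
      by (simp add: m c_def star_lie_def star_scaleR one J_def mult.commute flip: scaleR_2)
    moreover have "\<phi> (p_star n ?s) = p_star n (\<lambda>i. \<phi> (?s i))"
      using map by (simp add: multiplicative_star_lie_jordan_map_def)
    ultimately have "(2 * c) *\<^sub>R \<phi> (\<iota> * x) = (2 * c) *\<^sub>R (J * \<phi> x)"
      by (simp add: scaled)
    with double_c_nonzero show ?thesis by (rule scaleR_left_imp_eq)
  qed
  \<comment> \<open>This makes \<open>J\<close> left cancellable.\<close>
  have J_fourth: "J * (J * (J * (J * y))) = y" for y
  proof -
    obtain x where x: "\<phi> x = y" using bij by (metis bij_pointE)
    have "J * (J * (J * (J * \<phi> x))) = \<phi> (\<iota> * (\<iota> * (\<iota> * (\<iota> * x))))"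
      by (simp only: image_\<iota>_mult)
    also have "\<iota> * (\<iota> * (\<iota> * (\<iota> * x))) = x"
      by (simp only: \<iota>_square minus_minus)
    finally show ?thesis by (simp only: x)
  qed

  have halved_lie: "\<phi> ((1/2) *\<^sub>R star_lie x y) = (1/2) *\<^sub>R star_lie (\<phi> x) (\<phi> y)" for x y
  proof -
    have image_star: "star (J * \<phi> x) = - (J * star (\<phi> x))"
      by (simp add: star_mult J_skew J_central)
    have "y * (\<iota> * star x) = \<iota> * (y * star x)"
      by (simp add: \<iota>_def mult_scaleC_left mult_scaleC_right)
    then have "J * \<phi> ((1/2) *\<^sub>R star_lie x y) = \<phi> ((1/2) *\<^sub>R star_jordan (\<iota> * x) y)"
      by (simp add: star_lie_def star_jordan_def star_mult \<iota>_star \<iota>_central algebra_simps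
          flip: image_\<iota>_mult)
    also have "\<dots> = (1/2) *\<^sub>R star_jordan (J * \<phi> x) (\<phi> y)"
      by (simp only: halved_jordan image_\<iota>_mult)
    also have "\<dots> = (1/2) *\<^sub>R (J * \<phi> x * \<phi> y - \<phi> y * J * star (\<phi> x))"
      by (simp add: star_jordan_def image_star mult.assoc)
    also have "\<dots> = J * ((1/2) *\<^sub>R star_lie (\<phi> x) (\<phi> y))"
      by (simp add: star_lie_def right_diff_distrib mult.assoc flip: J_central[of "\<phi> y"])
    finally show ?thesis by (metis J_fourth)
  qed

  show ?thesis
    by unfold_locales (fact bij zero one halved_jordan halved_lie)+
qed

section \<open>The characterisation\<close>

lemma n_map_of_star_ring_isomorphism:
  assumes "star_ring_isomorphism \<phi>"
  shows "bij \<phi>" and "\<phi> 1 = 1" and "multiplicative_star_lie_jordan_map n \<phi>"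
proof -
  have add: "\<phi> (x + y) = \<phi> x + \<phi> y" and mult: "\<phi> (x * y) = \<phi> x * \<phi> y"
    and star: "\<phi> (star x) = star (\<phi> x)" for x y
    using assms by (simp_all add: star_ring_isomorphism_def)
  show bij: "bij \<phi>" using assms by (simp add: star_ring_isomorphism_def)
  obtain u where u: "\<phi> u = 1" using bij by (metis bij_pointE)
  show "\<phi> 1 = 1" using mult[of 1 u] u by simp
  have diff: "\<phi> (x - y) = \<phi> x - \<phi> y" for x y
    using add[of "x - y" y] by simp
  have zero: "\<phi> 0 = 0" using diff[of 0 0] by simp
  have lie: "\<phi> (star_lie x y) = star_lie (\<phi> x) (\<phi> y)"
    and jordan: "\<phi> (star_jordan x y) = star_jordan (\<phi> x) (\<phi> y)" for x y
    by (simp_all add: star_lie_def star_jordan_def add diff mult star)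
  have "\<phi> (p_star n x) = p_star n (\<lambda>i. \<phi> (x i))" for x
    by (induction n x rule: p_star.induct) (simp_all add: zero lie)
  moreover have "\<phi> (q_star n x) = q_star n (\<lambda>i. \<phi> (x i))" for x
    by (induction n x rule: q_star.induct) (simp_all add: zero jordan)
  ultimately show "multiplicative_star_lie_jordan_map n \<phi>"
    by (simp add: multiplicative_star_lie_jordan_map_def)
qed

theorem theorem3p1:
  fixes n :: nat
    and \<phi> :: "'a::unital_cstar_algebra \<Rightarrow> 'b::unital_cstar_algebra"
    and P\<^sub>1 P\<^sub>2 :: 'a
  assumes "n \<ge> 2"
    and "P\<^sub>2 = 1 - P\<^sub>1"
    and "nontrivial_projection P\<^sub>1"
    and "nontrivial_projection P\<^sub>2"
    and "\<And>P X. P \<in> {P\<^sub>1, P\<^sub>2} \<Longrightarrow> (\<forall>Y. X * Y * \<phi> P = 0) \<Longrightarrow> X = 0"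
  shows "(bij \<phi> \<and> \<phi> 1 = 1 \<and> multiplicative_star_lie_jordan_map n \<phi>) \<longleftrightarrow>
         star_ring_isomorphism \<phi>"
proof
  assume "bij \<phi> \<and> \<phi> 1 = 1 \<and> multiplicative_star_lie_jordan_map n \<phi>"
  then interpret halved_lie_jordan \<phi>
    using halved_lie_jordan_of_n_map[OF \<open>n \<ge> 2\<close>] by blast
  interpret halved_lie_jordan_peirce \<phi> P\<^sub>1 P\<^sub>2
    using assms by unfold_locales (auto simp: nontrivial_projection_def)
  show "star_ring_isomorphism \<phi>"
    by (rule star_ring_isomorphism_if_additive) (rule additive)
qed (use n_map_of_star_ring_isomorphism in blast)

end
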